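(* There exist (finite, simple) bipartite graphs $G$ for which the independent set sequence $i(G) = (i_t(G))_{t=0}^{\alpha(G)}$ is not unimodal.
   Context: For a graph $G=(V,E)$, an independent set is a set of vertices spanning no edges. For an integer $t \geq 0$, $i_t(G)$ denotes the number of independent sets of size $t$ in $G$, and $\alpha(G)$ denotes the size of a largest independent set in $G$. The independent set sequence of $G$ is $i(G) = (i_t(G))_{t=0}^{\alpha(G)}$. It is unimodal if there is a $k$ (with $0 \leq k \leq \alpha(G)$) for which $i_0(G) \leq i_1(G) \leq \cdots \leq i_k(G) \geq i_{k+1}(G) \geq \cdots \geq i_{\alpha(G)}(G)$. *)

theory Defs
  imports "Graph_Theory.Pair_Digraph"
begin

text \<open>
  Finite simple graphs are the \<^term>\<open>pair_graph\<close>s of the Graph_Theory library: finite vertex set,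
  and a loop-free symmetric set of ordered pairs, so an undirected edge uv is represented by the
  two arcs \<open>(u, v)\<close> and \<open>(v, u)\<close>. The definitions below are meant for such graphs; in particular
  finiteness ensures that \<^const>\<open>card\<close> and \<^const>\<open>Max\<close> have their intended meaning.
\<close>

definition bipartite :: "'a pair_pre_digraph \<Rightarrow> bool" where
  "bipartite G \<longleftrightarrow> (\<exists>A B. pverts G = A \<union> B \<and> A \<inter> B = {} \<and> parcs G \<subseteq> A \<times> B \<union> B \<times> A)"

definition independent_set :: "'a pair_pre_digraph \<Rightarrow> 'a set \<Rightarrow> bool" where
  "independent_set G S \<longleftrightarrow> S \<subseteq> pverts G \<and> (\<forall>u\<in>S. \<forall>v\<in>S. (u, v) \<notin> parcs G)"

definition indep_count :: "'a pair_pre_digraph \<Rightarrow> nat \<Rightarrow> nat" where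
  "indep_count G t = card {S. independent_set G S \<and> card S = t}"

definition indep_number :: "'a pair_pre_digraph \<Rightarrow> nat" where
  "indep_number G = Max (card ` {S. independent_set G S})"

text \<open>Unimodality of the finite sequence \<open>a 0, \<dots>, a n\<close>; values of \<open>a\<close> beyond \<open>n\<close> play no role.\<close>

definition unimodal_upto :: "(nat \<Rightarrow> nat) \<Rightarrow> nat \<Rightarrow> bool" where
  "unimodal_upto a n \<longleftrightarrow>
    (\<exists>k\<le>n. (\<forall>t<k. a t \<le> a (Suc t)) \<and> (\<forall>t. k \<le> t \<and> t < n \<longrightarrow> a t \<ge> a (Suc t)))"

definition unimodal_indep_seq :: "'a pair_pre_digraph \<Rightarrow> bool" where
  "unimodal_indep_seq G \<longleftrightarrow> unimodal_upto (indep_count G) (indep_number G)"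

end

theory Submission
  imports Defs
begin

text \<open>
  Bhattacharyya and Kahn's example: start from a perfect matching between two \<open>m\<close>-sets and join
  one of them completely to \<open>a\<close> further vertices. The independent sets of size \<open>t\<close> inside the side
  with \<open>m + a\<close> vertices number \<open>(m + a) choose t\<close>, which peaks near \<open>t = (m + a) / 2\<close>; all others
  live in the matching and number \<open>(2 ^ t - 1) * (m choose t)\<close>, which peaks near \<open>t = 2 * m / 3\<close>.
  The two peaks have comparable heights when \<open>2 ^ (m + a)\<close> is close to \<open>3 ^ m\<close>, and then the sum
  has a valley in between. The smallest \<open>m\<close> for which this happens is \<open>m = 79\<close>, with \<open>a = 47\<close>.
\<close>

text \<open>All arcs start below \<open>m\<close>. Independence looks at both orders of a pair, so
  it can be tested on this single orientation, which leaves one shape of arc in later case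
  distinctions.\<close>

definition matching_join_arcs :: "nat \<Rightarrow> nat \<Rightarrow> (nat \<times> nat) set" where
  "matching_join_arcs m a = {(i, j). i < m \<and> (j = i + m \<or> j \<in> {2 * m..<2 * m + a})}"

definition matching_join :: "nat \<Rightarrow> nat \<Rightarrow> nat pair_pre_digraph" where
  "matching_join m a =
    \<lparr>pverts = {..<2 * m + a}, parcs = matching_join_arcs m a \<union> (matching_join_arcs m a)\<inverse>\<rparr>"

lemma pair_graph_matching_join: "pair_graph (matching_join m a)"
proof -
  have "matching_join_arcs m a \<subseteq> {..<2 * m + a} \<times> {..<2 * m + a}"
    by (auto simp: matching_join_arcs_def)
  moreover from this have "finite (matching_join_arcs m a)"
    by (rule finite_subset) simp
  moreover have "(i, i) \<notin> matching_join_arcs m a" for i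
    by (auto simp: matching_join_arcs_def)
  ultimately show ?thesis
    by unfold_locales (auto simp: matching_join_def symmetric_def sym_Un_converse)
qed

lemma bipartite_matching_join: "bipartite (matching_join m a)"
  unfolding bipartite_def
  by (rule exI[of _ "{..<m}"], rule exI[of _ "{m..<2 * m + a}"])
    (auto simp: matching_join_def matching_join_arcs_def)

lemma independent_set_matching_join_iff:
  "independent_set (matching_join m a) S \<longleftrightarrow>
    S \<subseteq> {..<2 * m + a} \<and> (\<forall>i\<in>S. \<forall>j\<in>S. (i, j) \<notin> matching_join_arcs m a)"
  by (auto simp: independent_set_def matching_join_def)

lemma independent_set_matching_join_far_side:
  "S \<subseteq> {m..<2 * m + a} \<Longrightarrow> independent_set (matching_join m a) S"
  by (fastforce simp: independent_set_matching_join_iff matching_join_arcs_def)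

text \<open>A vertex below \<open>m\<close> excludes all \<open>a\<close> further vertices, so such
  a set picks one end from each of \<open>t\<close> matching edges. The near ends picked form a
  nonempty subset of these edges, hence the factor \<open>2 ^ t - 1\<close>.\<close>

lemma card_independent_sets_meeting_near_side:
  "card {S. independent_set (matching_join m a) S \<and> card S = t \<and> S \<inter> {..<m} \<noteq> {}} =
    (2 ^ t - 1) * (m choose t)"
proof -
  \<comment> \<open>\<open>J\<close> is the set of matching edges used and \<open>K\<close> those used at their end below \<open>m\<close>.\<close>
  define P where "P = (SIGMA J:{J. J \<subseteq> {..<m} \<and> card J = t}. Pow J - {{}})"
  define f :: "nat set \<times> nat set \<Rightarrow> nat set" where "f = (\<lambda>(J, K). K \<union> (\<lambda>i. i + m) ` (J - K))"
  define g :: "nat set \<Rightarrow> nat set \<times> nat set"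
    where "g = (\<lambda>S. ({i. i < m \<and> (i \<in> S \<or> i + m \<in> S)}, S \<inter> {..<m}))"
  define T where "T = {S. independent_set (matching_join m a) S \<and> card S = t \<and> S \<inter> {..<m} \<noteq> {}}"
  have card_f: "card (f (J, K)) = card J" if "J \<subseteq> {..<m}" "K \<subseteq> J" for J K
  proof -
    have fin: "finite J"
      using that(1) by (rule finite_subset) simp
    with that(2) have "finite K"
      by (rule finite_subset)
    have "card (f (J, K)) = card K + card ((\<lambda>i. i + m) ` (J - K))"
      unfolding f_def prod.case using that fin \<open>finite K\<close> by (intro card_Un_disjoint) auto
    also have "card ((\<lambda>i. i + m) ` (J - K)) = card (J - K)"
      by (rule card_image) (simp add: inj_on_def)
    finally show ?thesis
      using that fin \<open>finite K\<close> by (simp add: card_Diff_subset card_mono)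
  qed
  have fg: "f (g S) = S" if S: "S \<in> T" for S
  proof -
    have arcs: "S \<subseteq> {..<2 * m + a}" "\<forall>i\<in>S. \<forall>j\<in>S. (i, j) \<notin> matching_join_arcs m a"
      using that by (auto simp: T_def independent_set_matching_join_iff)
    obtain i where i: "i \<in> S" "i < m"
      using S by (auto simp: T_def)
    \<comment> \<open>The vertex \<open>i\<close> is adjacent to every vertex from
      \<open>2 * m\<close> on.\<close>
    have small: "j < 2 * m" if "j \<in> S" for j
      using arcs i that by (force simp: matching_join_arcs_def)
    have edge: "j + m \<notin> S" if "j \<in> S" "j < m" for j
      using arcs(2) that by (force simp: matching_join_arcs_def)
    have "j \<in> f (g S)" if "j \<in> S" for j
    proof (cases "j < m")
      case False
      \<comment> \<open>Here \<open>j\<close> is the far end of edge \<open>k\<close>. Its near end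
        is missing from \<open>S\<close>, so \<open>g\<close> puts \<open>k\<close> into the first
        component only and \<open>f\<close> restores \<open>k + m\<close>.\<close>
      then obtain k where k: "j = k + m"
        by (metis add.commute le_iff_add not_less)
      then have "k < m" "k \<notin> S"
        using small[OF that] edge[of k] that by auto
      then show ?thesis
        using that k by (auto simp: f_def g_def)
    qed (use that in \<open>simp add: f_def g_def\<close>)
    then show ?thesis
      by (auto simp: f_def g_def)
  qed
  have gf: "g (f p) = p" if "p \<in> P" for p
    using that by (auto simp: P_def f_def g_def)
  have "bij_betw f P T"
  proof (rule bij_betwI)
    show "f \<in> P \<rightarrow> T"
    proof
      fix p assume "p \<in> P"
      then obtain J K where p: "p = (J, K)" "J \<subseteq> {..<m}" "card J = t" "K \<subseteq> J" "K \<noteq> {}"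
        by (auto simp: P_def)
      have "independent_set (matching_join m a) (f p)"
        using p(2,4) unfolding p(1)
        by (fastforce simp: independent_set_matching_join_iff matching_join_arcs_def f_def)
      moreover have "f p \<inter> {..<m} \<noteq> {}"
        using p by (auto simp: f_def)
      ultimately show "f p \<in> T"
        using p card_f by (simp add: T_def)
    qed
    show "g \<in> T \<rightarrow> P"
    proof
      fix S assume S: "S \<in> T"
      \<comment> \<open>The touched edges are not counted directly: \<open>f\<close> turns them into
        \<open>S\<close> and keeps the size.\<close>
      have "card (f (g S)) = card (fst (g S))"
        using card_f[of "fst (g S)" "snd (g S)"] by (fastforce simp: g_def)
      then show "g S \<in> P"
        using S fg[OF S] by (auto simp: P_def g_def T_def)
    qed
  qed (use fg gf in auto)
  then have "card T = card P"
    by (simp add: bij_betw_same_card)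
  also have "\<dots> = (\<Sum>J\<in>{J. J \<subseteq> {..<m} \<and> card J = t}. card (Pow J - {{}}))"
    unfolding P_def by (rule card_SigmaI) (auto intro: finite_subset)
  also have "\<dots> = (\<Sum>J\<in>{J. J \<subseteq> {..<m} \<and> card J = t}. 2 ^ t - 1)"
    by (intro sum.cong) (auto simp: card_Diff_subset card_Pow finite_subset)
  also have "\<dots> = (2 ^ t - 1) * (m choose t)"
    by (simp add: n_subsets)
  finally show ?thesis
    by (simp add: T_def)
qed

text \<open>The summands separate the independent sets that meet \<open>{..<m}\<close> from those
  that avoid it. The latter are arbitrary subsets of the other side, which has \<open>m + a\<close>
  vertices.\<close>

lemma indep_count_matching_join:
  "indep_count (matching_join m a) t = (2 ^ t - 1) * (m choose t) + ((m + a) choose t)"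
proof -
  let ?I = "{S. independent_set (matching_join m a) S \<and> card S = t}"
  let ?T = "{S. independent_set (matching_join m a) S \<and> card S = t \<and> S \<inter> {..<m} \<noteq> {}}"
  let ?U = "{S. S \<subseteq> {m..<2 * m + a} \<and> card S = t}"
  have fin: "finite ?I"
    by (rule finite_subset[of _ "Pow {..<2 * m + a}"])
      (auto simp: independent_set_matching_join_iff)
  have split: "?I = ?T \<union> ?U"
  proof (rule set_eqI)
    fix S
    have "S \<subseteq> {m..<2 * m + a}"
      if "independent_set (matching_join m a) S" "S \<inter> {..<m} = {}"
      using that by (force simp: independent_set_matching_join_iff not_less)
    then show "S \<in> ?I \<longleftrightarrow> S \<in> ?T \<union> ?U"
      using independent_set_matching_join_far_side[of S m a] by auto
  qed
  have "card ?I = card ?T + card ?U"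
  proof -
    have "finite ?T" "finite ?U"
      using fin unfolding split by simp_all
    moreover have "?T \<inter> ?U = {}"
      by auto
    ultimately show ?thesis
      unfolding split by (rule card_Un_disjoint)
  qed
  then show ?thesis
    by (simp add: indep_count_def card_independent_sets_meeting_near_side n_subsets)
qed

text \<open>The whole far side is independent. This bound places the later ascent inside the
  sequence.\<close>

lemma indep_number_matching_join_ge: "m + a \<le> indep_number (matching_join m a)"
proof -
  have "finite {S. independent_set (matching_join m a) S}"
    by (rule finite_subset[of _ "Pow {..<2 * m + a}"])
      (auto simp: independent_set_matching_join_iff)
  moreover have "independent_set (matching_join m a) {m..<2 * m + a}"
    by (rule independent_set_matching_join_far_side) simp
  ultimately have "card {m..<2 * m + a} \<le> indep_number (matching_join m a)"
    unfolding indep_number_def by (intro Max_ge finite_imageI imageI CollectI)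
  then show ?thesis
    by simp
qed

text \<open>A peak \<open>k\<close> would need \<open>k \<le> p\<close> because of the descent and
  \<open>q < k\<close> because of the ascent, against \<open>p < q\<close>.\<close>

lemma not_unimodal_upto_if_descent_ascent:
  assumes "p < q" "q < n" "a (Suc p) < a p" "a q < a (Suc q)"
  shows "\<not> unimodal_upto a n"
proof
  assume "unimodal_upto a n"
  then obtain k where up: "\<And>t. t < k \<Longrightarrow> a t \<le> a (Suc t)"
    and down: "\<And>t. k \<le> t \<Longrightarrow> t < n \<Longrightarrow> a (Suc t) \<le> a t"
    by (auto simp: unimodal_upto_def)
  show False
    using up[of p] down[of q] assms by (cases "q < k") auto
qed

text \<open>Reduces checking a large binomial coefficient to one product of factorials, avoiding
  Pascal's recursion and division.\<close>

lemma binomial_eqI: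
  assumes "k \<le> n" "c * (fact k * fact (n - k)) = (fact n :: nat)"
  shows "n choose k = c"
proof -
  have "(fact k * fact (n - k)) * (n choose k) = (fact k * fact (n - k)) * c"
    using binomial_fact_lemma[OF assms(1)] assms(2) by (simp add: mult.commute)
  then show ?thesis
    by simp
qed

theorem theorem1p1:
  shows "\<exists>G :: nat pair_pre_digraph. pair_graph G \<and> bipartite G \<and> \<not> unimodal_indep_seq G"
proof -
  have choose:
    "79 choose 56 = (48671481846629972460 :: nat)"
    "79 choose 57 = (19639369867938409940 :: nat)"
    "79 choose 58 = (7449416156804224460 :: nat)"
    "79 choose 59 = (2651487106659130740 :: nat)"
    "126 choose 56 = (2785304168505255002682442853459013525 :: nat)"
    "126 choose 57 = (3420548978866102634873175434072472750 :: nat)"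
    "126 choose 58 = (4069273785202777272521536292258631375 :: nat)"
    "126 choose 59 = (4690010464301506009007872336840456500 :: nat)"
    by (simp_all add: binomial_eqI fact_numeral)
  let ?i = "indep_count (matching_join 79 47)"
  \<comment> \<open>At 56 the matching term, past its peak near 53, falls faster than the far-side
    term grows; by 58 the far-side term, still below its peak at 63, has taken over.\<close>
  have "?i (Suc 56) < ?i 56" "?i 58 < ?i (Suc 58)"
    by (simp_all add: indep_count_matching_join choose)
  moreover have "58 < indep_number (matching_join 79 47)"
    using indep_number_matching_join_ge[of 79 47] by simp
  ultimately have "\<not> unimodal_indep_seq (matching_join 79 47)"
    unfolding unimodal_indep_seq_def
    by (intro not_unimodal_upto_if_descent_ascent[of 56 58]) simp_all
  then show ?thesis
    using pair_graph_matching_join bipartite_matching_join by blast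
qed

end
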